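(* Let $(P,d)$ be a finite metric space, let $k \ge 1$ be an integer, let $\delta > 0$, and let $Q \subseteq P$ be a $\delta$-cover of $P$ with $|Q| \ge k$. Then $$\mathrm{cost}(\mathrm{FF}(Q),P) \le 2\,\mathrm{OPT} + \delta .$$ That is, for every set $C \subseteq Q$ with $|C|=k$ that is the output of some valid execution of farthest-first traversal on $Q$ with parameter $k$ (any initial center, any tie-breaking), $\mathrm{cost}(C,P) \le 2\,\mathrm{OPT} + \delta$.
   Context: Let $(P,d)$ be a finite metric space and $k\ge 1$ an integer. For $s \in P$ and nonempty $C \subseteq P$, $d(s,C) := \min_{c \in C} d(s,c)$. For nonempty $C, S \subseteq P$, $\mathrm{cost}(C,S) := \max_{s \in S} d(s,C)$. The optimal $k$-center cost of the full set $P$ is $\mathrm{OPT} := \min\{\mathrm{cost}(C,P) : C \subseteq P,\ |C| = k\}$. For $\delta>0$, a subset $Q \subseteq P$ is a $\delta$-cover of $P$ if for every $p \in P$ there exists $q \in Q$ with $d(p,q) \le \delta$. Farthest-first traversal on $S \subseteq P$ (with $|S|\ge k$): choose $c_1 \in S$ arbitrarily and set $C = \{c_1\}$; for $i = 2,\dots,k$, choose $c_i \in S$ maximizing $d(s,C)$ over $s \in S$ (ties broken arbitrarily) and replace $C$ by $C \cup \{c_i\}$; return $C$, which has $|C|=k$. $\mathrm{FF}(S)$ denotes any set of centers obtainable by a valid execution of this procedure on $S$; statements about $\mathrm{FF}(S)$ are asserted for all valid executions. *)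

theory Defs
  imports "HOL-Analysis.Abstract_Metric_Spaces"
begin

text \<open>
  All of the \<open>Min\<close> and \<open>Max\<close> below are meant for finite nonempty sets: the point set \<open>P\<close>
  is finite, and sets of centers are nonempty subsets of it.
\<close>

definition pt_set_dist :: "('a \<Rightarrow> 'a \<Rightarrow> real) \<Rightarrow> 'a \<Rightarrow> 'a set \<Rightarrow> real" where
  "pt_set_dist d s C = Min {d s c | c. c \<in> C}"

definition cost :: "('a \<Rightarrow> 'a \<Rightarrow> real) \<Rightarrow> 'a set \<Rightarrow> 'a set \<Rightarrow> real" where
  "cost d C S = Max {pt_set_dist d s C | s. s \<in> S}"

definition OPT :: "('a \<Rightarrow> 'a \<Rightarrow> real) \<Rightarrow> 'a set \<Rightarrow> nat \<Rightarrow> real" where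
  "OPT d P k = Min {cost d C P | C. C \<subseteq> P \<and> card C = k}"

definition delta_cover :: "('a \<Rightarrow> 'a \<Rightarrow> real) \<Rightarrow> real \<Rightarrow> 'a set \<Rightarrow> 'a set \<Rightarrow> bool" where
  "delta_cover d \<delta> P Q \<longleftrightarrow> Q \<subseteq> P \<and> (\<forall>p\<in>P. \<exists>q\<in>Q. d p q \<le> \<delta>)"

text \<open>
  \<open>FF d S i C\<close>: some valid execution of farthest-first traversal on \<open>S\<close> has the set of
  centers \<open>C\<close> after choosing \<open>c\<^sub>1, \<dots>, c\<^sub>i\<close>.  The outputs for the parameter \<open>k\<close> are
  thus the sets \<open>C\<close> with \<open>FF d S k C\<close>.
\<close>

inductive FF :: "('a \<Rightarrow> 'a \<Rightarrow> real) \<Rightarrow> 'a set \<Rightarrow> nat \<Rightarrow> 'a set \<Rightarrow> bool"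
  for d S where
  init: "c \<in> S \<Longrightarrow> FF d S 1 {c}"
| step: "\<lbrakk>FF d S i C; c \<in> S; \<forall>s\<in>S. pt_set_dist d s C \<le> pt_set_dist d c C\<rbrakk>
         \<Longrightarrow> FF d S (Suc i) (C \<union> {c})"

end

theory Submission imports Defs begin

text \<open>
  If some point of \<open>Q\<close> were at distance more than \<open>2 OPT\<close> from the traversal's centers, then by the
  greedy choice it would form with them \<open>k + 1\<close> points at pairwise distance more than \<open>2 OPT\<close>; two
  of these share a nearest center in an optimal solution, contradicting the triangle inequality.
  So the centers are within \<open>2 OPT\<close> of \<open>Q\<close>, and the cover adds \<open>\<delta>\<close>.
\<close>

lemma pt_set_dist_le_iff:
  assumes "finite C" "C \<noteq> {}"
  shows "pt_set_dist d s C \<le> t \<longleftrightarrow> (\<exists>c\<in>C. d s c \<le> t)"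
  using assms unfolding pt_set_dist_def Setcompr_eq_image by (subst Min_le_iff) auto

lemma cost_le_iff:
  assumes "finite S" "S \<noteq> {}"
  shows "cost d C S \<le> t \<longleftrightarrow> (\<forall>s\<in>S. pt_set_dist d s C \<le> t)"
  using assms unfolding cost_def Setcompr_eq_image by (subst Max_le_iff) auto

text \<open>\<open>Min\<close> is a member of its set only if that set is finite and nonempty:
  \<open>Pow P\<close> bounds the candidates, and \<open>k \<le> card P\<close> supplies
  one.\<close>

lemma OPT_attained:
  assumes "finite P" "k \<le> card P"
  obtains C where "C \<subseteq> P" "card C = k" "OPT d P k = cost d C P"
proof -
  obtain C where "C \<subseteq> P" "card C = k"
    using assms(2) by (meson obtain_subset_with_card_n)
  then have "{cost d C P | C. C \<subseteq> P \<and> card C = k} \<noteq> {}"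
    by blast
  moreover have "finite {cost d C P | C. C \<subseteq> P \<and> card C = k}"
    by (rule finite_subset[where B = "(\<lambda>C. cost d C P) ` Pow P"]) (use assms(1) in auto)
  ultimately have "OPT d P k \<in> {cost d C P | C. C \<subseteq> P \<and> card C = k}"
    unfolding OPT_def using Min_in by blast
  with that show thesis
    by blast
qed

lemma FF_subset:
  assumes "FF d S i C"
  shows "finite C \<and> C \<noteq> {} \<and> C \<subseteq> S"
  using assms by induction auto

text \<open>The far point \<open>q\<close> is a witness for every earlier stage: each greedy choice
  is at least as far from its predecessors as \<open>q\<close> is. The cardinality is part of the
  claim because \<open>FF\<close> by itself allows a step to choose a center again.\<close>

lemma FF_separated:
  assumes "FF d S i C"
    and "\<And>x y. d x y = d y x" and "\<And>x. x \<in> S \<Longrightarrow> d x x \<le> t"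
    and "q \<in> S" and "t < pt_set_dist d q C"
  shows "card C = i \<and> pairwise (\<lambda>x y. t < d x y) C"
  using assms(1,5)
proof induction
  case (init c)
  then show ?case by simp
next
  case (step i C c)
  have C: "finite C" "C \<noteq> {}" "C \<subseteq> S"
    using FF_subset[OF step.hyps(1)] by auto
  \<comment> \<open>Removing \<open>c\<close> can only increase the distance of \<open>q\<close>, so
    the induction hypothesis applies with the same \<open>q\<close>.\<close>
  have q: "t < pt_set_dist d q C"
    using step.prems C pt_set_dist_le_iff[of C d q t] pt_set_dist_le_iff[of "C \<union> {c}" d q t]
    by (auto simp: not_le[symmetric])
  also have "\<dots> \<le> pt_set_dist d c C"
    using step.hyps(3) assms(4) by blast
  finally have far: "\<forall>x\<in>C. t < d c x"
    using pt_set_dist_le_iff[OF C(1,2), of d c t] by force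
  \<comment> \<open>Otherwise \<open>far\<close> would give \<open>t < d c c\<close>, against the
    bound on the diagonal. So the cardinality really grows by one.\<close>
  then have "c \<notin> C"
    using assms(3) step.hyps(2) by force
  with far step.IH[OF q] C(1) show ?case
    by (auto simp: pairwise_insert assms(2))
qed

text \<open>Pigeonhole against an arbitrary competitor \<open>K\<close> with \<open>k\<close>
  centers and radius \<open>r\<close>; the optimum enters only when this is instantiated.\<close>

lemma FF_pt_set_dist_le:
  assumes "Metric_space P d" "finite P" "S \<subseteq> P" "FF d S k C"
    and K: "K \<subseteq> P" "card K = k" "K \<noteq> {}" and "cost d K P \<le> r" and "q \<in> S"
  shows "pt_set_dist d q C \<le> 2 * r"
proof (rule ccontr)
  interpret Metric_space P d by fact
  assume "\<not> ?thesis"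
  then have q: "2 * r < pt_set_dist d q C"
    by simp
  have "finite K"
    using assms(2) K(1) finite_subset by blast
  have "q \<in> P"
    using assms by blast
  have "\<forall>p\<in>P. \<exists>c\<in>K. d p c \<le> r"
    using \<open>cost d K P \<le> r\<close> \<open>q \<in> P\<close> cost_le_iff[OF \<open>finite P\<close>] pt_set_dist_le_iff[OF \<open>finite K\<close> K(3)]
    by fastforce
  \<comment> \<open>Any center within \<open>r\<close> serves as \<open>f p\<close>;
    \<open>f\<close> will be the map into pigeonholes.\<close>
  then obtain f where f: "\<And>p. p \<in> P \<Longrightarrow> f p \<in> K \<and> d p (f p) \<le> r"
    by metis
  \<comment> \<open>This makes \<open>d x x = 0\<close> at most \<open>2 * r\<close>, as
    \<open>FF_separated\<close> demands, and keeps \<open>q\<close> out of \<open>C\<close>.\<close>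
  have "0 \<le> r"
    using f[OF \<open>q \<in> P\<close>] nonneg order_trans by blast
  have C: "finite C" "C \<noteq> {}" "C \<subseteq> S"
    using FF_subset[OF assms(4)] by auto
  have "d x x \<le> 2 * r" if "x \<in> S" for x
    using that \<open>0 \<le> r\<close> assms(3) by auto
  then have sep: "card C = k" "pairwise (\<lambda>x y. 2 * r < d x y) C"
    using FF_separated[OF assms(4) commute _ \<open>q \<in> S\<close> q] by auto
  have far: "\<forall>x\<in>C. 2 * r < d q x"
    using q pt_set_dist_le_iff[OF C(1,2), of d q "2 * r"] by force
  have "q \<notin> C"
    using far \<open>0 \<le> r\<close> \<open>q \<in> P\<close> by force
  have sep': "pairwise (\<lambda>x y. 2 * r < d x y) (insert q C)"
    using sep(2) far by (auto simp: pairwise_insert commute)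
  have sub: "insert q C \<subseteq> P"
    using C(3) assms(3) \<open>q \<in> P\<close> by blast
  \<comment> \<open>There are \<open>k + 1\<close> separated points, but only \<open>k\<close>
    values for \<open>f\<close>.\<close>
  have "card K < card (insert q C)"
    using \<open>q \<notin> C\<close> C(1) sep(1) K(2) by simp
  moreover have "f ` insert q C \<subseteq> K"
    using f sub by blast
  ultimately have "\<not> inj_on f (insert q C)"
    using card_inj_on_le[of f "insert q C" K] \<open>finite K\<close> by linarith
  then obtain x y where xy: "x \<in> insert q C" "y \<in> insert q C" "f x = f y" "x \<noteq> y"
    unfolding inj_on_def by blast
  then have P: "x \<in> P" "y \<in> P"
    using sub by auto
  \<comment> \<open>The detour goes through the shared center; since \<open>f x = f y\<close>, both
    legs are at most \<open>r\<close>.\<close>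
  have "d x y \<le> d x (f x) + d y (f x)"
    using triangle[of x "f x" y] f[OF P(1)] K(1) P by (auto simp: commute)
  also have "\<dots> \<le> 2 * r"
    using f[OF P(1)] f[OF P(2)] xy(3) by simp
  finally show False
    using pairwiseD[OF sep' xy(1,2,4)] by simp
qed

theorem theorem2:
  fixes P Q C :: "'a set" and d :: "'a \<Rightarrow> 'a \<Rightarrow> real" and k :: nat and \<delta> :: real
  assumes "Metric_space P d" and "finite P"
    and "k \<ge> 1" and "\<delta> > 0"
    and "delta_cover d \<delta> P Q" and "card Q \<ge> k"
    and "FF d Q k C"
  shows "cost d C P \<le> 2 * OPT d P k + \<delta>"
proof -
  interpret Metric_space P d by fact
  have "Q \<subseteq> P" and cover: "\<And>p. p \<in> P \<Longrightarrow> \<exists>q\<in>Q. d p q \<le> \<delta>"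
    using assms(5) by (auto simp: delta_cover_def)
  have C: "finite C" "C \<noteq> {}" "C \<subseteq> Q"
    using FF_subset[OF assms(7)] by auto
  have "k \<le> card P"
    using assms(6) card_mono[OF \<open>finite P\<close> \<open>Q \<subseteq> P\<close>] by linarith
  then obtain K where K: "K \<subseteq> P" "card K = k" "OPT d P k = cost d K P"
    using OPT_attained[OF \<open>finite P\<close>] by blast
  \<comment> \<open>As \<open>k\<close> is positive, distances to \<open>K\<close> are minima over a
    nonempty set.\<close>
  then have "K \<noteq> {}"
    using assms(3) by auto
  have "pt_set_dist d p C \<le> 2 * OPT d P k + \<delta>" if "p \<in> P" for p
  proof -
    obtain q where q: "q \<in> Q" "d p q \<le> \<delta>"
      using cover \<open>p \<in> P\<close> by blast
    \<comment> \<open>Here \<open>r\<close> is \<open>OPT d P k\<close> itself, attained by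
      \<open>K\<close>.\<close>
    have "pt_set_dist d q C \<le> 2 * OPT d P k"
      using FF_pt_set_dist_le[OF assms(1,2) \<open>Q \<subseteq> P\<close> assms(7) K(1,2) \<open>K \<noteq> {}\<close> _ q(1)] K(3) by simp
    then obtain c where c: "c \<in> C" "d q c \<le> 2 * OPT d P k"
      using pt_set_dist_le_iff[OF C(1,2)] by blast
    have "d p c \<le> d p q + d q c"
      using triangle \<open>p \<in> P\<close> q(1) c(1) C(3) \<open>Q \<subseteq> P\<close> by blast
    then have "d p c \<le> 2 * OPT d P k + \<delta>"
      using q(2) c(2) by linarith
    then show ?thesis
      using c(1) pt_set_dist_le_iff[OF C(1,2)] by blast
  qed
  moreover have "P \<noteq> {}"
    using C \<open>Q \<subseteq> P\<close> by blast
  ultimately show ?thesis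
    using cost_le_iff[OF \<open>finite P\<close>] by blast
qed

end
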